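(* Let $\delta=\frac{2}{33}$. There is an absolute constant $K>0$ such that for every finite set $A\subset\mathbb{R}$ with $|A|\geq 2$ there exist disjoint subsets $B$ and $C$ of $A$ with $A=B\cup C$, $$\max\{E_+(B),E_\times(C)\}\leq K|A|^{3-\delta}(\log|A|)^{1-\delta}$$ and $$\max\{E_+(B,C),E_\times(B,C)\}\leq K|A|^{3-\delta/2}(\log|A|)^{(1-\delta)/2}.$$
   Context: For finite sets $A,B$ of real numbers, $|A|$ denotes cardinality, and the additive and multiplicative energies are $$E_+(A)=\mathrm{card}\{(a_1,a_2,a_3,a_4)\in A^4: a_1+a_2=a_3+a_4\},$$ $$E_\times(A)=\mathrm{card}\{(a_1,a_2,a_3,a_4)\in A^4: a_1a_2=a_3a_4\},$$ $$E_+(A,B)=\mathrm{card}\{(a_1,a_2,b_1,b_2)\in A^2\times B^2: a_1+b_1=a_2+b_2\},$$ $$E_\times(A,B)=\mathrm{card}\{(a_1,a_2,b_1,b_2)\in A^2\times B^2: a_1b_1=a_2b_2\}.$$ The subsets $B$ and $C$ are allowed to be empty (the energies involving an empty set are $0$). *)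

theory Defs
  imports Complex_Main
begin

definition add_energy :: "real set \<Rightarrow> nat" where
  "add_energy A =
     card {(a1, a2, a3, a4) \<in> A \<times> A \<times> A \<times> A. a1 + a2 = a3 + a4}"

definition mult_energy :: "real set \<Rightarrow> nat" where
  "mult_energy A =
     card {(a1, a2, a3, a4) \<in> A \<times> A \<times> A \<times> A. a1 * a2 = a3 * a4}"

definition add_energy_pair :: "real set \<Rightarrow> real set \<Rightarrow> nat" where
  "add_energy_pair A B =
     card {(a1, a2, b1, b2) \<in> A \<times> A \<times> B \<times> B. a1 + b1 = a2 + b2}"

definition mult_energy_pair :: "real set \<Rightarrow> real set \<Rightarrow> nat" where
  "mult_energy_pair A B =
     card {(a1, a2, b1, b2) \<in> A \<times> A \<times> B \<times> B. a1 * b1 = a2 * b2}"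

end

theory Submission
  imports Defs "HOL-Analysis.L2_Norm"
begin

text \<open>
  Write \<open>n = |A|\<close> and \<open>K = n\<^sup>\<delta>\<close>. A finite set with many additive quadruples contains a large
  piece with few multiplicative ones; moving such pieces from \<open>A\<close> to \<open>C\<close> until none is left
  gives the decomposition.

  Suppose \<open>B \<subseteq> A\<close> has additive energy above \<open>n\<^sup>3/K\<close>. Then the set \<open>P\<close> of differences with at least
  \<open>n/(2K)\<close> representations in \<open>B\<close> carries at least half of the energy, has at most \<open>2Kn\<close> elements, and at
  least \<open>n/(4K)\<close> elements \<open>a\<close> of \<open>B\<close> satisfy \<open>a - b \<in> P\<close> for at least \<open>n/(4K)\<close> elements \<open>b\<close> of
  \<open>B\<close>. Let \<open>X\<close> be the set of these \<open>a\<close> (\<open>large_add_energy_obtains_structured\<close>).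

  Such an \<open>X\<close> has small multiplicative energy with every \<open>Y \<subseteq> A\<close>
  (\<open>mult_energy_pair_structured_le\<close>). If \<open>z = a y\<close> with \<open>a \<in> X\<close> and \<open>y \<in> Y\<close>, then
  \<open>z (1/y) - b \<in> P\<close> for many \<open>b\<close>: the point \<open>(1/y, a - b)\<close> of a grid with sides \<open>|Y|\<close> and \<open>|P|\<close>
  lies on the line of slope \<open>z\<close> and intercept \<open>-b\<close>. A popular product \<open>z\<close> therefore yields many
  lines containing many grid points. For a grid the Szemeredi-Trotter bound on rich lines has an
  elementary proof (\<open>sum_rich_lines_le\<close>): a line is monotone, so it meets few cells when the grid
  is cut into blocks, most of its points share a cell with another of its points, and such a pair
  determines the line. This bounds the number of popular products, and gives
  \<open>E\<^sub>\<times>(X, Y) = O(n\<^sup>3/K\<^sup>3)\<close> as soon as \<open>K\<^sup>1\<^sup>4 \<le> n\<close>.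

  The pieces are combined through \<open>\<surd>E\<^sub>\<times>(C, Y)\<close>, which is the Euclidean norm of a representation
  function and hence subadditive in \<open>C\<close>. As each piece has at least \<open>n/(4K)\<close> elements, there are at
  most \<open>4K\<close> of them, so that \<open>E\<^sub>\<times>(C, Y) = O(K\<^sup>2 n\<^sup>3/K\<^sup>3) = O(n\<^sup>3/K)\<close> for all \<open>Y \<subseteq> A\<close>
  (\<open>low_energy_decomposition\<close>). Taking \<open>Y = C\<close> and \<open>Y = B\<close> gives both multiplicative bounds, and
  \<open>E\<^sub>+(B, C) \<le> \<surd>E\<^sub>+(B) \<surd>E\<^sub>+(C) \<le> n\<^sup>3/\<surd>K\<close> by Cauchy-Schwarz. The exponent \<open>\<delta> = 2/33\<close> satisfies
  \<open>14 \<delta> \<le> 1\<close>, and the logarithmic factors are at least \<open>1/2\<close>, which costs a factor 2 in the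
  constant.
\<close>

section \<open>Energies as sums over representation counts\<close>

definition diff_reps :: "real set \<Rightarrow> real \<Rightarrow> nat" where
  "diff_reps X d = card {(a, b) \<in> X \<times> X. a - b = d}"

definition prod_reps :: "real set \<Rightarrow> real set \<Rightarrow> real \<Rightarrow> nat" where
  "prod_reps X Y z = card {(a, y) \<in> X \<times> Y. a * y = z}"

lemma card_coincidences:
  assumes "finite S" "finite S'" "finite T" "f ` S \<subseteq> T"
  shows "card {(p, q) \<in> S \<times> S'. f p = g q}
    = (\<Sum>v\<in>T. card {p \<in> S. f p = v} * card {q \<in> S'. g q = v})"
proof -
  have "{(p, q) \<in> S \<times> S'. f p = g q} = (\<Union>v\<in>T. {p \<in> S. f p = v} \<times> {q \<in> S'. g q = v})"
    using assms(4) by auto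
  also have "card \<dots> = (\<Sum>v\<in>T. card ({p \<in> S. f p = v} \<times> {q \<in> S'. g q = v}))"
    using assms(1-3) by (intro card_UN_disjoint) auto
  finally show ?thesis by (simp add: card_cartesian_product)
qed

lemma sum_card_fibres:
  assumes "finite S" "finite T" "f ` S \<subseteq> T"
  shows "(\<Sum>v\<in>T. card {p \<in> S. f p = v}) = card S"
  using assms sum.group[of S T f "\<lambda>_. 1::nat"] by simp

text \<open>
  The equation \<open>a\<^sub>1 + b\<^sub>1 = a\<^sub>2 + b\<^sub>2\<close> reads \<open>a\<^sub>1 - a\<^sub>2 = b\<^sub>2 - b\<^sub>1\<close>. Working with differences decouples the
  two sets, so that Cauchy-Schwarz applies to the sum on the right.
\<close>

lemma add_energy_pair_eq_sum:
  assumes "finite X" "finite Y" "finite T" "(\<lambda>(a, b). a - b) ` (X \<times> X) \<subseteq> T"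
  shows "add_energy_pair X Y = (\<Sum>d\<in>T. diff_reps X d * diff_reps Y d)"
proof -
  have "card {(p, q) \<in> (X \<times> X) \<times> (Y \<times> Y). (case p of (a, b) \<Rightarrow> a - b) = (case q of (a, b) \<Rightarrow> a - b)}
      = add_energy_pair X Y"
    unfolding add_energy_pair_def
    by (rule bij_betw_same_card[of "\<lambda>((a1, a2), (b1, b2)). (a1, a2, b2, b1)"],
        rule bij_betw_byWitness[where f' = "\<lambda>(a1, a2, b1, b2). ((a1, a2), (b2, b1))"])
       (auto simp: algebra_simps)
  then show ?thesis
    using card_coincidences[of "X \<times> X" "Y \<times> Y" T "\<lambda>(a, b). a - b" "\<lambda>(a, b). a - b"] assms
    by (simp add: diff_reps_def case_prod_unfold mem_Times_iff)
qed

lemma add_energy_eq_pair: "add_energy X = add_energy_pair X X"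
  unfolding add_energy_def add_energy_pair_def
  by (rule bij_betw_same_card[of "\<lambda>(a1, a2, a3, a4). (a1, a3, a2, a4)"],
      rule bij_betw_byWitness[where f' = "\<lambda>(a1, a3, a2, a4). (a1, a2, a3, a4)"]) auto

lemma mult_energy_eq_pair: "mult_energy X = mult_energy_pair X X"
  unfolding mult_energy_def mult_energy_pair_def
  by (rule bij_betw_same_card[of "\<lambda>(a1, a2, a3, a4). (a1, a3, a2, a4)"],
      rule bij_betw_byWitness[where f' = "\<lambda>(a1, a3, a2, a4). (a1, a2, a3, a4)"]) auto

lemma mult_energy_pair_commute: "mult_energy_pair X Y = mult_energy_pair Y X"
  unfolding mult_energy_pair_def
  by (rule bij_betw_same_card[of "\<lambda>(a1, a2, b1, b2). (b1, b2, a1, a2)"],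
      rule bij_betw_byWitness[where f' = "\<lambda>(a1, a2, b1, b2). (b1, b2, a1, a2)"])
     (auto simp: algebra_simps)

lemma mult_energy_pair_eq_sum:
  assumes "finite X" "finite Y" "finite T" "(\<lambda>(a, y). a * y) ` (X \<times> Y) \<subseteq> T"
  shows "mult_energy_pair X Y = (\<Sum>z\<in>T. (prod_reps X Y z)\<^sup>2)"
proof -
  have "card {(p, q) \<in> (X \<times> Y) \<times> (X \<times> Y). (case p of (a, b) \<Rightarrow> a * b) = (case q of (a, b) \<Rightarrow> a * b)}
      = mult_energy_pair X Y"
    unfolding mult_energy_pair_def
    by (rule bij_betw_same_card[of "\<lambda>((a1, b1), (a2, b2)). (a1, a2, b1, b2)"],
        rule bij_betw_byWitness[where f' = "\<lambda>(a1, a2, b1, b2). ((a1, b1), (a2, b2))"])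
       auto
  then show ?thesis
    using card_coincidences[of "X \<times> Y" "X \<times> Y" T "\<lambda>(a, b). a * b" "\<lambda>(a, b). a * b"] assms
    by (simp add: prod_reps_def case_prod_unfold mem_Times_iff power2_eq_square)
qed

section \<open>Rich lines in a grid\<close>

text \<open>
  The quotient \<open>rank_in U u div G\<close> numbers the block of \<open>u\<close> when \<open>U\<close>, listed increasingly, is cut
  into blocks of \<open>G\<close> consecutive elements. The rank is defined at every real number, so it can
  be compared along a line \<open>q = m u - b\<close> without knowing which values are in the grid.
\<close>

definition rank_in :: "real set \<Rightarrow> real \<Rightarrow> nat" where
  "rank_in U u = card {v \<in> U. v < u}"

lemma rank_in_mono: "finite U \<Longrightarrow> u \<le> v \<Longrightarrow> rank_in U u \<le> rank_in U v"
  unfolding rank_in_def by (intro card_mono) auto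

lemma rank_in_le_card: "finite U \<Longrightarrow> rank_in U u \<le> card U"
  unfolding rank_in_def by (intro card_mono) auto

lemma rank_in_strict_mono:
  assumes "finite U" "u \<in> U" "u < v"
  shows "rank_in U u < rank_in U v"
proof -
  have "{w \<in> U. w < u} \<subset> {w \<in> U. w < v}"
    using assms by force
  then show ?thesis
    unfolding rank_in_def using assms(1) by (intro psubset_card_mono) auto
qed

lemma card_block_le:
  assumes "finite U" "0 < G"
  shows "card {v \<in> U. rank_in U v div G = k} \<le> G"
proof -
  have inj: "inj_on (rank_in U) {v \<in> U. rank_in U v div G = k}"
  proof (rule inj_onI)
    fix u v assume "u \<in> {v \<in> U. rank_in U v div G = k}" "v \<in> {v \<in> U. rank_in U v div G = k}"
      and "rank_in U u = rank_in U v"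
    then show "u = v"
      using rank_in_strict_mono[OF assms(1), of u v] rank_in_strict_mono[OF assms(1), of v u]
      by (cases u v rule: linorder_cases) auto
  qed
  have "rank_in U ` {v \<in> U. rank_in U v div G = k} \<subseteq> {k * G..<k * G + G}"
    using dividend_less_div_times[OF assms(2)] by (auto simp: add.commute)
  then have "card {v \<in> U. rank_in U v div G = k} \<le> card {k * G..<k * G + G}"
    using inj by (intro card_inj_on_le) auto
  then show ?thesis by simp
qed

text \<open>
  The elements that are last with their label have distinct labels.
\<close>

lemma card_le_labels_plus_repeats:
  fixes X :: "'a::linorder set"
  assumes "finite X" "finite Lab" "f ` X \<subseteq> Lab"
  shows "card X \<le> card Lab + card {u \<in> X. \<exists>v\<in>X. u < v \<and> f v = f u}"
proof -
  let ?R = "{u \<in> X. \<exists>v\<in>X. u < v \<and> f v = f u}"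
  have "inj_on f (X - ?R)"
  proof (rule inj_onI)
    fix u v assume "u \<in> X - ?R" "v \<in> X - ?R" "f u = f v"
    then show "u = v" by (cases u v rule: linorder_cases) auto
  qed
  then have "card (X - ?R) \<le> card Lab"
    using assms by (intro card_inj_on_le[of f]) auto
  moreover have "card X \<le> card (X - ?R) + card ?R"
    using assms(1) by (subst card_Diff_subset) auto
  ultimately show ?thesis by linarith
qed

text \<open>
  Along an increasing line both block numbers can only increase, so points with equal sums
  lie in the same cell; along a decreasing line this holds for the difference. Hence the cells met by the line are
  labelled by \<open>card U div G + card Q div H + 1\<close> integers, and if the line has at least twice as many
  points, then half of them are followed by another point in the same cell.
\<close>

lemma line_repeats_cells:
  fixes m b :: real
  assumes "finite U" "finite Q" "m \<noteq> 0"
  defines "X \<equiv> {u \<in> U. m * u - b \<in> Q}"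
  assumes rich: "2 * (card U div G + card Q div H + 1) \<le> card X"
  shows "card X \<le> 2 * card {u \<in> X. \<exists>v\<in>X. u < v \<and> rank_in U v div G = rank_in U u div G
            \<and> rank_in Q (m * v - b) div H = rank_in Q (m * u - b) div H}"
    (is "_ \<le> 2 * card ?W")
proof -
  define i where "i = (\<lambda>u. rank_in U u div G)"
  define j where "j = (\<lambda>u. rank_in Q (m * u - b) div H)"
  define \<sigma> :: int where "\<sigma> = (if m > 0 then 1 else - 1)"
  define f where "f = (\<lambda>u. int (i u) + \<sigma> * int (j u))"
  define I where "I = card U div G"
  define J where "J = card Q div H"
  have fin: "finite X" unfolding X_def using assms(1) by simp
  have iI: "i u \<le> I" for u
    unfolding i_def I_def using rank_in_le_card[OF assms(1)] by (intro div_le_mono)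
  have jJ: "j u \<le> J" for u
    unfolding j_def J_def using rank_in_le_card[OF assms(2)] by (intro div_le_mono)
  define Lab where "Lab = (if m > 0 then {0..int I + int J} else {- int J..int I})"
  have Lab: "f ` X \<subseteq> Lab"
  proof
    fix z assume "z \<in> f ` X"
    then obtain u where "z = f u" by auto
    then show "z \<in> Lab" using iI[of u] jJ[of u] by (auto simp: f_def \<sigma>_def Lab_def)
  qed
  have cardLab: "card Lab = I + J + 1" unfolding Lab_def by auto
  have same: "i v = i u \<and> j v = j u" if "u < v" "f v = f u" for u v
  proof -
    have i: "i u \<le> i v"
      unfolding i_def using that(1) assms(1) by (intro div_le_mono rank_in_mono) auto
    show ?thesis
    proof (cases "m > 0")
      case True
      then have "j u \<le> j v"
        unfolding j_def using that(1) assms(2) by (intro div_le_mono rank_in_mono) auto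
      then show ?thesis using i that(2) True by (auto simp: f_def \<sigma>_def)
    next
      case False
      then have "m * v \<le> m * u" using that(1) by (simp add: mult_left_mono_neg)
      then have "j v \<le> j u"
        unfolding j_def using assms(2) by (intro div_le_mono rank_in_mono) auto
      then show ?thesis using i that(2) False by (auto simp: f_def \<sigma>_def)
    qed
  qed
  have "card X \<le> card Lab + card {u \<in> X. \<exists>v\<in>X. u < v \<and> f v = f u}"
    using fin Lab by (intro card_le_labels_plus_repeats) (auto simp: Lab_def)
  also have "card {u \<in> X. \<exists>v\<in>X. u < v \<and> f v = f u} \<le> card ?W"
    using same fin by (intro card_mono) (auto simp: i_def j_def)
  finally show ?thesis using rich cardLab by (simp add: I_def J_def)
qed

text \<open>
  This is the Szemeredi-Trotter bound for rich lines in a Cartesian product: when \<open>s\<close> exceeds an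
  absolute constant and \<open>G\<close> and \<open>H\<close> are suitable multiples of \<open>card U / s\<close> and \<open>card Q / s\<close>, it
  says that the non-horizontal lines \<open>q = m u - b\<close> with at least \<open>s\<close> points have
  \<open>O((card U)\<^sup>2 (card Q)\<^sup>2 / s\<^sup>2)\<close> incidences altogether. Two points in a common cell determine
  their line, and there are at most \<open>card U * card Q * G * H\<close> pairs of points in a common cell.
\<close>

lemma sum_rich_lines_le:
  fixes U Q :: "real set" and L :: "(real \<times> real) set"
  assumes "finite U" "finite Q" "finite L" "0 < G" "0 < H"
    and nz: "\<And>m b. (m, b) \<in> L \<Longrightarrow> m \<noteq> 0"
    and rich: "\<And>m b. (m, b) \<in> L \<Longrightarrow>
      2 * (card U div G + card Q div H + 1) \<le> card {u \<in> U. m * u - b \<in> Q}"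
  shows "(\<Sum>(m, b)\<in>L. card {u \<in> U. m * u - b \<in> Q}) \<le> 2 * (card U * card Q * G * H)"
proof -
  define X where "X = (\<lambda>m b. {u \<in> U. m * u - b \<in> Q})"
  define partner where "partner = (\<lambda>m b u v. v \<in> X m b \<and> u < v \<and> rank_in U v div G = rank_in U u div G
            \<and> rank_in Q (m * v - b) div H = rank_in Q (m * u - b) div H)"
  define W where "W = (\<lambda>(m, b). {u \<in> X m b. \<exists>v. partner m b u v})"
  define g where "g = (\<lambda>((m, b), u). let v = SOME v. partner m b u v in ((u, m * u - b), (v, m * v - b)))"
  define Cell where "Cell = (\<lambda>(u, q). {v \<in> U. rank_in U v div G = rank_in U u div G}
            \<times> {q' \<in> Q. rank_in Q q' div H = rank_in Q q div H})"
  have gE: "\<exists>v. partner m b u v \<and> g ((m, b), u) = ((u, m * u - b), (v, m * v - b))"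
    if "((m, b), u) \<in> Sigma L W" for m b u
  proof -
    have "\<exists>v. partner m b u v" using that by (auto simp: W_def)
    then have "partner m b u (SOME v. partner m b u v)" by (rule someI_ex)
    then show ?thesis by (auto simp: g_def Let_def)
  qed
  have inj: "inj_on g (Sigma L W)"
  proof (rule inj_onI)
    fix p p' assume p: "p \<in> Sigma L W" "p' \<in> Sigma L W" and eq: "g p = g p'"
    obtain m b u where [simp]: "p = ((m, b), u)" by (metis surj_pair)
    obtain m' b' u' where [simp]: "p' = ((m', b'), u')" by (metis surj_pair)
    obtain v where v: "partner m b u v" "g p = ((u, m * u - b), (v, m * v - b))"
      using gE[of m b u] p(1) by auto
    obtain v' where v': "partner m' b' u' v'" "g p' = ((u', m' * u' - b'), (v', m' * v' - b'))"
      using gE[of m' b' u'] p(2) by auto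
    have "u' = u" "v' = v" and 1: "m * u - b = m' * u - b'" "m * v - b = m' * v - b'"
      using eq v v' by auto
    \<comment> \<open>Two points with distinct abscissae determine the slope, and then the intercept.\<close>
    from 1 have "(m - m') * (v - u) = 0" by (simp add: algebra_simps)
    moreover have "u < v" using v(1) by (auto simp: partner_def)
    ultimately have "m = m'" by auto
    with 1 show "p = p'" using \<open>u' = u\<close> by auto
  qed
  have img: "g ` Sigma L W \<subseteq> Sigma (U \<times> Q) Cell"
  proof
    fix z assume "z \<in> g ` Sigma L W"
    then obtain m b u where p: "((m, b), u) \<in> Sigma L W" "z = g ((m, b), u)" by auto
    then obtain v where "partner m b u v" "z = ((u, m * u - b), (v, m * v - b))" using gE by metis
    moreover have "u \<in> X m b" using p(1) by (auto simp: W_def)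
    ultimately show "z \<in> Sigma (U \<times> Q) Cell" by (auto simp: Cell_def partner_def X_def)
  qed
  have cell: "card (Cell p) \<le> G * H" for p
    unfolding Cell_def using assms by (cases p) (auto simp: card_cartesian_product intro!: mult_mono card_block_le)
  have finC: "finite (Cell p)" for p using assms by (cases p) (auto simp: Cell_def)
  have finW: "finite (W l)" for l using assms by (cases l) (auto simp: W_def X_def)
  have "card {u \<in> U. m * u - b \<in> Q} \<le> 2 * card (W (m, b))" if "(m, b) \<in> L" for m b
    using line_repeats_cells[OF assms(1,2) nz[OF that] rich[OF that]]
    by (simp add: W_def X_def partner_def Bex_def conj_ac)
  then have "(\<Sum>(m, b)\<in>L. card {u \<in> U. m * u - b \<in> Q}) \<le> (\<Sum>l\<in>L. 2 * card (W l))"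
    by (intro sum_mono) auto
  also have "\<dots> = 2 * card (Sigma L W)"
    using assms finW by (simp add: sum_distrib_left)
  also have "card (Sigma L W) \<le> card (Sigma (U \<times> Q) Cell)"
    using inj img assms finC by (intro card_inj_on_le) auto
  also have "card (Sigma (U \<times> Q) Cell) = (\<Sum>p\<in>U \<times> Q. card (Cell p))"
    using assms finC by simp
  also have "\<dots> \<le> (\<Sum>p\<in>U \<times> Q. G * H)" by (intro sum_mono cell)
  also have "\<dots> = card U * card Q * G * H" by (simp add: card_cartesian_product)
  finally show ?thesis by simp
qed

section \<open>Structured sets have small multiplicative energy\<close>

lemma sum_card_swap:
  assumes "finite B" "finite U"
  shows "(\<Sum>b\<in>B. card {u \<in> U. R b u}) = (\<Sum>u\<in>U. card {b \<in> B. R b u})"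
proof -
  have "(\<Sum>b\<in>B. card {u \<in> U. R b u}) = (\<Sum>b\<in>B. \<Sum>u\<in>U. if R b u then 1 else 0)"
    using assms by (simp add: sum.If_cases Int_def)
  also have "\<dots> = (\<Sum>u\<in>U. \<Sum>b\<in>B. if R b u then 1 else 0)" by (rule sum.swap)
  also have "\<dots> = (\<Sum>u\<in>U. card {b \<in> B. R b u})"
    using assms by (simp add: sum.If_cases Int_def)
  finally show ?thesis .
qed

text \<open>
  Reciprocals of second factors serve as abscissae: on them the first factor \<open>a = z u\<close> is a linear
  function with slope \<open>z\<close>.
\<close>

lemma prod_reps_eq_card_reciprocals:
  assumes "z \<noteq> 0"
  shows "prod_reps X Y z = card {u \<in> inverse ` (Y - {0}). z * u \<in> X}"
  unfolding prod_reps_def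
  by (rule bij_betw_same_card[of "\<lambda>(a, y). inverse y"],
      rule bij_betw_byWitness[where f' = "\<lambda>u. (z * u, inverse u)"])
     (use assms in \<open>auto simp: field_simps\<close>)

lemma prod_reps_le_card:
  assumes "finite Y" "z \<noteq> 0"
  shows "prod_reps X Y z \<le> card Y"
proof -
  have "prod_reps X Y z \<le> card (inverse ` (Y - {0}))"
    unfolding prod_reps_eq_card_reciprocals[OF assms(2)] using assms(1) by (intro card_mono) auto
  also have "\<dots> \<le> card (Y - {0})" using assms(1) by (intro card_image_le) auto
  also have "\<dots> \<le> card Y" using assms(1) by (intro card_mono) auto
  finally show ?thesis .
qed

lemma prod_reps_0_le:
  assumes "finite X" "finite Y"
  shows "prod_reps X Y 0 \<le> card X + card Y"
proof -
  have "prod_reps X Y 0 \<le> card (X \<times> {0::real} \<union> {0::real} \<times> Y)"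
    unfolding prod_reps_def using assms by (intro card_mono) auto
  also have "\<dots> \<le> card X + card Y"
    by (rule order_trans[OF card_Un_le]) (simp add: card_cartesian_product)
  finally show ?thesis .
qed

text \<open>
  Let \<open>r z\<close> count the representations of \<open>z\<close> as a product and let \<open>N z b\<close> count the grid points on
  the line with slope \<open>z\<close> and intercept \<open>-b\<close>. Each representation of \<open>z\<close> puts points on at least
  \<open>n/(4K)\<close> of the lines with slope \<open>z\<close>, so \<open>n/(4K) r z \<le> (\<Sum>b\<in>B. N z b)\<close>. When \<open>r z \<ge> T\<close>, at least
  half of this comes from lines with at least \<open>s\<close> points, and the bound on rich lines controls the sum of
  \<open>r z\<close> over these \<open>z\<close>. The other \<open>z\<close> contribute at most \<open>T\<close> times the number \<open>card X * card Y\<close> of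
  all pairs to the energy.

  The threshold \<open>T\<close> is of order \<open>n/K\<^sup>3\<close> because the unpopular products may contribute
  \<open>O(n\<^sup>3/K\<^sup>3)\<close>, and \<open>s\<close> is determined by \<open>n s = n/(8K) T\<close>. The block lengths \<open>G\<close> and \<open>H\<close> are
  about \<open>8 n/s\<close> and \<open>8 (2 K n)/s\<close>, so a line meets at most about \<open>s/4\<close> cells. The popular products
  then contribute \<open>O(K\<^sup>1\<^sup>1 n\<^sup>2)\<close>, which is where \<open>K\<^sup>1\<^sup>4 \<le> n\<close> is needed.
\<close>

lemma mult_energy_pair_structured_le:
  fixes n K :: real
  assumes fin: "finite X" "finite Y" "finite B" "finite P"
    and K: "1 \<le> K" "K ^ 14 \<le> n"
    and card_le: "card X \<le> n" "card Y \<le> n" "card B \<le> n" "card P \<le> 2 * K * n"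
    and reps: "\<And>a. a \<in> X \<Longrightarrow> n / (4 * K) \<le> card {b \<in> B. a - b \<in> P}"
  shows "mult_energy_pair X Y \<le> 516 * n ^ 3 / K ^ 3"
proof -
  define U where "U = inverse ` (Y - {0})"
  define N where "N = (\<lambda>z b. card {u \<in> U. z * u - b \<in> P})"
  define r where "r = (\<lambda>z. real (prod_reps X Y z))"
  define T where "T = 32 * n / K ^ 3"
  define s where "s = 4 * n / K ^ 4"
  define G where "G = nat \<lceil>2 * K ^ 4\<rceil>"
  define H where "H = nat \<lceil>4 * K ^ 5\<rceil>"
  define Z where "Z = (\<lambda>(a, y). a * y) ` (X \<times> Y)"
  define Heavy where "Heavy = {z \<in> Z. z \<noteq> 0 \<and> T \<le> r z}"
  define Rich where "Rich = (\<lambda>z. {b \<in> B. s \<le> N z b})"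
  have [simp]: "finite U" "finite Z" "finite Heavy" "\<And>z. finite (Rich z)"
    using fin by (auto simp: U_def Z_def Heavy_def Rich_def)
  have pos: "0 < K" "0 < n" "1 \<le> K ^ 4" "1 \<le> K ^ 5"
    using K by (auto intro: less_le_trans[OF _ K(2)])
  have K4: "K ^ 4 \<le> n"
    using K power_increasing[of 4 14 K] by linarith

  have cardU: "card U \<le> n"
  proof -
    have "card U \<le> card (Y - {0})" unfolding U_def using fin by (intro card_image_le) auto
    also have "\<dots> \<le> card Y" using fin by (intro card_mono) auto
    finally show ?thesis using card_le(2) by linarith
  qed

  have count: "n / (4 * K) * r z \<le> (\<Sum>b\<in>B. N z b)" if "z \<noteq> 0" for z
  proof -
    have "n / (4 * K) * r z = (\<Sum>u\<in>{u \<in> U. z * u \<in> X}. n / (4 * K))"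
      using prod_reps_eq_card_reciprocals[OF that] by (simp add: r_def U_def)
    also have "\<dots> \<le> (\<Sum>u\<in>{u \<in> U. z * u \<in> X}. real (card {b \<in> B. z * u - b \<in> P}))"
      by (intro sum_mono reps) auto
    also have "\<dots> \<le> (\<Sum>u\<in>U. real (card {b \<in> B. z * u - b \<in> P}))"
      by (intro sum_mono2) auto
    also have "\<dots> = (\<Sum>b\<in>B. N z b)"
      using sum_card_swap[of B U "\<lambda>b u. z * u - b \<in> P"] fin by (simp add: N_def flip: of_nat_sum)
    finally show ?thesis .
  qed

  have rich: "n / (8 * K) * r z \<le> (\<Sum>b\<in>Rich z. real (N z b))" if "z \<in> Heavy" for z
  proof -
    have "(\<Sum>b\<in>B. real (N z b)) = (\<Sum>b\<in>Rich z. real (N z b)) + (\<Sum>b\<in>B - Rich z. real (N z b))"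
      using fin by (subst sum.subset_diff[of "Rich z"]) (auto simp: Rich_def)
    also have "(\<Sum>b\<in>B - Rich z. real (N z b)) \<le> (\<Sum>b\<in>B - Rich z. s)"
      by (intro sum_mono) (auto simp: Rich_def)
    also have "\<dots> \<le> n * s"
    proof -
      have "card (B - Rich z) \<le> card B" using fin by (intro card_mono) auto
      then have "real (card (B - Rich z)) \<le> n" using card_le(3) by linarith
      moreover have "0 \<le> s" using pos by (simp add: s_def)
      ultimately show ?thesis unfolding sum_constant by (rule mult_right_mono)
    qed
    also have "n * s = n / (8 * K) * T"
      using pos by (simp add: s_def T_def field_simps power_eq_if)
    also have "\<dots> \<le> n / (8 * K) * r z"
      using that pos by (intro mult_left_mono) (auto simp: Heavy_def)
    finally have "(\<Sum>b\<in>B. real (N z b)) \<le> (\<Sum>b\<in>Rich z. real (N z b)) + n / (8 * K) * r z" by simp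
    moreover have "n / (4 * K) * r z = n / (8 * K) * r z + n / (8 * K) * r z"
      using pos by (simp add: field_simps)
    ultimately show ?thesis using count[of z] that by (auto simp: Heavy_def)
  qed

  have GH: "2 * K ^ 4 \<le> G" "G \<le> 3 * K ^ 4" "4 * K ^ 5 \<le> H" "H \<le> 5 * K ^ 5"
    unfolding G_def H_def using pos by linarith+
  have G0: "0 < G" and H0: "0 < H" using GH pos by (auto intro!: Nat.gr0I)
  have labels: "2 * real (card U div G + card P div H + 1) \<le> s"
  proof -
    have "real (card U div G) \<le> card U / G" by (rule of_nat_div_le_of_nat)
    also have "\<dots> \<le> n / (2 * K ^ 4)"
      using cardU GH pos by (intro frac_le) auto
    finally have 1: "real (card U div G) \<le> n / (2 * K ^ 4)" .
    have "real (card P div H) \<le> card P / H" by (rule of_nat_div_le_of_nat)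
    also have "\<dots> \<le> 2 * K * n / (4 * K ^ 5)"
      using card_le(4) GH pos by (intro frac_le) auto
    also have "\<dots> = n / (2 * K ^ 4)" using pos by (simp add: field_simps power_eq_if)
    finally have 2: "real (card P div H) \<le> n / (2 * K ^ 4)" .
    have "1 \<le> n / K ^ 4" using K4 pos by simp
    moreover have "s = 2 * (n / (2 * K ^ 4)) + 2 * (n / (2 * K ^ 4)) + 2 * (n / K ^ 4)"
      by (simp add: s_def)
    ultimately show ?thesis using 1 2 unfolding of_nat_add of_nat_1 by argo
  qed
  have "(\<Sum>(z, b)\<in>Sigma Heavy Rich. N z b) \<le> 2 * (card U * card P * G * H)"
    unfolding N_def
  proof (rule sum_rich_lines_le)
    fix z b assume zb: "(z, b) \<in> Sigma Heavy Rich"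
    then show "z \<noteq> 0" by (auto simp: Heavy_def)
    have "s \<le> N z b" using zb by (auto simp: Rich_def)
    then show "2 * (card U div G + card P div H + 1) \<le> card {u \<in> U. z * u - b \<in> P}"
      using labels unfolding N_def by linarith
  qed (use fin G0 H0 in auto)
  then have "real (\<Sum>(z, b)\<in>Sigma Heavy Rich. N z b) \<le> real (2 * (card U * card P * G * H))"
    by (simp only: of_nat_le_iff)
  also have "\<dots> = 2 * (real (card U) * real (card P) * (real G * real H))" by simp
  also have "\<dots> \<le> 2 * (n * (2 * K * n) * (3 * K ^ 4 * (5 * K ^ 5)))"
    using cardU card_le GH pos by (intro mult_mono) auto
  also have "\<dots> = 60 * n ^ 2 * K ^ 10" by (simp add: power_eq_if)
  finally have lines: "(\<Sum>z\<in>Heavy. \<Sum>b\<in>Rich z. real (N z b)) \<le> 60 * n ^ 2 * K ^ 10"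
    by (simp add: sum.Sigma case_prod_unfold)
  have "n / (8 * K) * (\<Sum>z\<in>Heavy. r z) \<le> (\<Sum>z\<in>Heavy. \<Sum>b\<in>Rich z. real (N z b))"
    unfolding sum_distrib_left by (intro sum_mono rich)
  with lines have "n / (8 * K) * (\<Sum>z\<in>Heavy. r z) \<le> 60 * n ^ 2 * K ^ 10" by linarith
  then have heavy: "n * (\<Sum>z\<in>Heavy. r z) \<le> 480 * n ^ 2 * K ^ 11"
    using pos by (simp add: field_simps power_eq_if)
  have "480 * n ^ 2 * K ^ 11 \<le> 480 * n ^ 3 / K ^ 3"
  proof -
    have "n ^ 2 * (K ^ 11 * K ^ 3) \<le> n ^ 2 * n"
      using K by (intro mult_left_mono) (auto simp flip: power_add)
    then show ?thesis using pos by (simp add: field_simps power_eq_if)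
  qed
  with heavy have heavy': "n * (\<Sum>z\<in>Heavy. r z) \<le> 480 * n ^ 3 / K ^ 3" by linarith

  have zero: "(r 0)\<^sup>2 \<le> 4 * n ^ 3 / K ^ 3"
  proof -
    have "r 0 \<le> 2 * n"
      using prod_reps_0_le[OF fin(1,2)] card_le(1,2) unfolding r_def by linarith
    then have "(r 0)\<^sup>2 \<le> (2 * n)\<^sup>2" by (intro power_mono) (auto simp: r_def)
    also have "\<dots> = 4 * n ^ 2 * 1" by (simp add: power_mult_distrib)
    also have "\<dots> \<le> 4 * n ^ 2 * (n / K ^ 3)"
    proof (intro mult_left_mono)
      show "1 \<le> n / K ^ 3" using K4 pos power_increasing[of 3 4 K] K by simp
    qed auto
    finally show ?thesis by (simp add: power_eq_if mult_ac)
  qed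

  have total: "(\<Sum>z\<in>Z. r z) \<le> n ^ 2"
  proof -
    have "(\<Sum>z\<in>Z. prod_reps X Y z) = card (X \<times> Y)"
      using sum_card_fibres[of "X \<times> Y" Z "\<lambda>(a, y). a * y"] fin
      by (simp add: Z_def prod_reps_def case_prod_unfold mem_Times_iff)
    then have "(\<Sum>z\<in>Z. r z) = real (card X) * real (card Y)"
      unfolding r_def by (metis card_cartesian_product of_nat_mult of_nat_sum)
    also have "\<dots> \<le> n * n" using card_le pos by (intro mult_mono) auto
    finally show ?thesis by (simp add: power2_eq_square)
  qed

  \<comment> \<open>The product \<open>0\<close> is treated apart: it has no line of nonzero slope, and it can have
    up to \<open>2 n\<close> representations.\<close>
  have pointwise: "(r z)\<^sup>2 \<le> T * r z + (if z \<in> Heavy then n * r z else 0) + (if z = 0 then (r 0)\<^sup>2 else 0)"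
    if "z \<in> Z" for z
  proof -
    have T0: "0 \<le> T * r z" "0 \<le> n * r z" using pos by (auto simp: T_def r_def)
    consider "z = 0" | "z \<in> Heavy" | "z \<noteq> 0" "r z < T" using \<open>z \<in> Z\<close> by (force simp: Heavy_def)
    then show ?thesis
    proof cases
      case 1 then show ?thesis using T0 by simp
    next
      case 2
      then have "r z \<le> n"
        using prod_reps_le_card[OF fin(2), of z X] card_le(2) by (simp add: Heavy_def r_def)
      then have "(r z)\<^sup>2 \<le> n * r z" by (simp add: power2_eq_square r_def mult_right_mono)
      then show ?thesis using 2 T0 by (simp add: Heavy_def)
    next
      case 3
      then have "(r z)\<^sup>2 \<le> T * r z" by (simp add: power2_eq_square r_def mult_right_mono)
      then show ?thesis using 3 T0 by simp
    qed
  qed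
  have "real (mult_energy_pair X Y) = (\<Sum>z\<in>Z. (r z)\<^sup>2)"
    using mult_energy_pair_eq_sum[of X Y Z] fin by (simp add: Z_def r_def)
  also have "\<dots> \<le> (\<Sum>z\<in>Z. T * r z + (if z \<in> Heavy then n * r z else 0) + (if z = 0 then (r 0)\<^sup>2 else 0))"
    by (intro sum_mono pointwise)
  also have "\<dots> = T * (\<Sum>z\<in>Z. r z) + n * (\<Sum>z\<in>Heavy. r z) + (\<Sum>z\<in>Z. if z = 0 then (r 0)\<^sup>2 else 0)"
  proof -
    have "Z \<inter> Heavy = Heavy" by (auto simp: Heavy_def)
    then show ?thesis by (simp add: sum.distrib sum_distrib_left sum.If_cases)
  qed
  also have "(\<Sum>z\<in>Z. if z = 0 then (r 0)\<^sup>2 else 0) \<le> (r 0)\<^sup>2" by simp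
  also have "T * (\<Sum>z\<in>Z. r z) \<le> T * n ^ 2"
    using total pos by (intro mult_left_mono) (auto simp: T_def)
  also have "T * n ^ 2 = 32 * n ^ 3 / K ^ 3" by (simp add: T_def power_eq_if mult_ac)
  finally have "real (mult_energy_pair X Y)
      \<le> 32 * n ^ 3 / K ^ 3 + n * (\<Sum>z\<in>Heavy. r z) + (r 0)\<^sup>2" by simp
  also have "\<dots> \<le> 32 * n ^ 3 / K ^ 3 + 480 * n ^ 3 / K ^ 3 + 4 * n ^ 3 / K ^ 3"
    using heavy' zero by (intro add_mono order_refl)
  also have "\<dots> = 516 * n ^ 3 / K ^ 3"
    unfolding add_divide_distrib[symmetric] distrib_right[symmetric] by simp
  finally show ?thesis .
qed

section \<open>Large additive energy yields a structured subset\<close>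

text \<open>
  Differences with fewer than \<open>n/(2K)\<close> representations account for at most \<open>n\<^sup>3/(2K)\<close> of the
  energy, so at least \<open>n\<^sup>2/(2K)\<close> pairs of \<open>B \<times> B\<close> have a popular difference. Elements of \<open>B\<close> that
  are the first entry of fewer than \<open>n/(4K)\<close> of these pairs account for at most half of them, and no
  element is the first entry of more than \<open>n\<close>, so at least \<open>n/(4K)\<close> elements remain.
\<close>

lemma large_add_energy_obtains_structured:
  fixes n K :: real
  assumes fin: "finite B" and K: "1 \<le> K" and n: "0 < n" "card B \<le> n"
    and large: "n ^ 3 / K < add_energy B"
  obtains X P where "X \<subseteq> B" "finite P" "card P \<le> 2 * K * n" "n / (4 * K) \<le> card X"
    "\<And>a. a \<in> X \<Longrightarrow> n / (4 * K) \<le> card {b \<in> B. a - b \<in> P}"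
proof -
  define D where "D = (\<lambda>(a, b). a - b) ` (B \<times> B)"
  define r where "r = (\<lambda>d. real (diff_reps B d))"
  define P where "P = {d \<in> D. n / (2 * K) \<le> r d}"
  define h where "h = (\<lambda>a. real (card {b \<in> B. a - b \<in> P}))"
  define X where "X = {a \<in> B. n / (4 * K) \<le> h a}"
  have [simp]: "finite D" "finite P" "finite X" using fin by (auto simp: D_def P_def X_def)
  have r0: "0 \<le> r d" for d by (simp add: r_def)
  have rn: "r d \<le> n" for d
  proof -
    have "diff_reps B d \<le> card B"
      unfolding diff_reps_def
      by (rule card_inj_on_le[of fst]) (use fin in \<open>auto simp: inj_on_def\<close>)
    then show ?thesis using n by (simp add: r_def)
  qed
  have total: "(\<Sum>d\<in>D. r d) \<le> n ^ 2"
  proof -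
    have "(\<Sum>d\<in>D. diff_reps B d) = card (B \<times> B)"
      using sum_card_fibres[of "B \<times> B" D "\<lambda>(a, b). a - b"] fin
      by (simp add: D_def diff_reps_def case_prod_unfold mem_Times_iff)
    then have "(\<Sum>d\<in>D. r d) = real (card B) * real (card B)"
      unfolding r_def by (metis card_cartesian_product of_nat_mult of_nat_sum)
    also have "\<dots> \<le> n * n" using n by (intro mult_mono) auto
    finally show ?thesis by (simp add: power2_eq_square)
  qed
  have PD: "P \<subseteq> D" by (auto simp: P_def)

  have "n / (2 * K) * card P = (\<Sum>d\<in>P. n / (2 * K))" by simp
  also have "\<dots> \<le> (\<Sum>d\<in>P. r d)" by (intro sum_mono) (auto simp: P_def)
  also have "\<dots> \<le> (\<Sum>d\<in>D. r d)" using PD r0 by (intro sum_mono2) auto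
  finally have "n / (2 * K) * card P \<le> n ^ 2" using total by linarith
  then have cardP: "card P \<le> 2 * K * n" using K n by (simp add: field_simps power2_eq_square)

  have "n ^ 3 / K < (\<Sum>d\<in>D. (r d)\<^sup>2)"
    using large add_energy_pair_eq_sum[of B B D] fin
    by (simp add: add_energy_eq_pair D_def r_def power2_eq_square)
  also have "\<dots> \<le> (\<Sum>d\<in>D. n / (2 * K) * r d + (if d \<in> P then n * r d else 0))"
  proof (intro sum_mono)
    fix d assume d: "d \<in> D"
    show "(r d)\<^sup>2 \<le> n / (2 * K) * r d + (if d \<in> P then n * r d else 0)"
    proof (cases "d \<in> P")
      case True
      have "(r d)\<^sup>2 \<le> n * r d" "0 \<le> n / (2 * K) * r d"
        using rn[of d] r0[of d] K n by (auto simp: power2_eq_square mult_right_mono)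
      then show ?thesis using True by simp
    next
      case False
      then have "r d \<le> n / (2 * K)" using d by (simp add: P_def)
      then have "(r d)\<^sup>2 \<le> n / (2 * K) * r d"
        unfolding power2_eq_square using r0 by (intro mult_right_mono) auto
      then show ?thesis using False by simp
    qed
  qed
  also have "\<dots> = n / (2 * K) * (\<Sum>d\<in>D. r d) + n * (\<Sum>d\<in>P. r d)"
  proof -
    have "D \<inter> P = P" using PD by auto
    then show ?thesis by (simp add: sum.distrib sum_distrib_left sum.If_cases)
  qed
  also have "n / (2 * K) * (\<Sum>d\<in>D. r d) \<le> n / (2 * K) * n ^ 2"
    using total K n by (intro mult_left_mono) auto
  finally have "n ^ 3 / K < n / (2 * K) * n ^ 2 + n * (\<Sum>d\<in>P. r d)" by simp
  then have "n * (n ^ 2 / (2 * K)) < n * (\<Sum>d\<in>P. r d)"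
    using K by (simp add: field_simps power_eq_if)
  then have "n ^ 2 / (2 * K) < (\<Sum>d\<in>P. r d)"
    using n(1) by (simp only: mult_less_cancel_left_pos)
  also have "(\<Sum>d\<in>P. r d) = (\<Sum>a\<in>B. h a)"
  proof -
    have "(\<Sum>d\<in>P. diff_reps B d) = card {p \<in> B \<times> B. fst p - snd p \<in> P}"
    proof -
      have "{q \<in> {p \<in> B \<times> B. fst p - snd p \<in> P}. fst q - snd q = d} = {(a, b) \<in> B \<times> B. a - b = d}"
        if "d \<in> P" for d using that by auto
      then show ?thesis
        using sum_card_fibres[of "{p \<in> B \<times> B. fst p - snd p \<in> P}" P "\<lambda>p. fst p - snd p"] fin
        by (simp add: diff_reps_def image_subset_iff cong: sum.cong)
    qed
    also have "{p \<in> B \<times> B. fst p - snd p \<in> P} = Sigma B (\<lambda>a. {b \<in> B. a - b \<in> P})" by auto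
    also have "card \<dots> = (\<Sum>a\<in>B. card {b \<in> B. a - b \<in> P})" using fin by simp
    finally show ?thesis by (simp add: r_def h_def flip: of_nat_sum)
  qed
  also have "\<dots> \<le> (\<Sum>a\<in>B. n / (4 * K) + (if a \<in> X then n else 0))"
  proof (intro sum_mono)
    fix a assume a: "a \<in> B"
    have "card {b \<in> B. a - b \<in> P} \<le> card B" using fin by (intro card_mono) auto
    then have "h a \<le> n" using n by (simp add: h_def)
    then show "h a \<le> n / (4 * K) + (if a \<in> X then n else 0)"
      using a K n by (auto simp: X_def add_increasing)
  qed
  also have "\<dots> = card B * (n / (4 * K)) + card X * n"
  proof -
    have "B \<inter> X = X" by (auto simp: X_def)
    then show ?thesis using fin by (simp add: sum.distrib sum.If_cases)
  qed
  also have "\<dots> \<le> n * (n / (4 * K)) + card X * n"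
    using n K by (intro add_mono mult_right_mono) auto
  finally have "n * (n / (4 * K)) < n * card X"
    using K by (simp add: field_simps power_eq_if)
  then have "n / (4 * K) < card X"
    using n(1) by (simp only: mult_less_cancel_left_pos)
  then have "n / (4 * K) \<le> card X" by simp
  with cardP show ?thesis by (intro that[of X P]) (auto simp: X_def h_def)
qed

section \<open>The decomposition\<close>

text \<open>
  By \<open>mult_energy_pair_eq_sum\<close> the square root of the energy is the Euclidean norm of
  \<open>prod_reps\<close>, which is subadditive in its first set.
\<close>

lemma sqrt_mult_energy_pair_Un_le:
  assumes fin: "finite C" "finite X" "finite Y"
  shows "sqrt (mult_energy_pair (C \<union> X) Y) \<le> sqrt (mult_energy_pair C Y) + sqrt (mult_energy_pair X Y)"
proof -
  define T where "T = (\<lambda>(a, y). a * y) ` ((C \<union> X) \<times> Y)"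
  have energy: "sqrt (mult_energy_pair V Y) = L2_set (\<lambda>z. real (prod_reps V Y z)) T" if "V \<subseteq> C \<union> X" for V
  proof -
    have "mult_energy_pair V Y = (\<Sum>z\<in>T. (prod_reps V Y z)\<^sup>2)"
      using that fin finite_subset[OF that] by (intro mult_energy_pair_eq_sum) (auto simp: T_def)
    then show ?thesis by (simp add: L2_set_def)
  qed
  have Un: "prod_reps (C \<union> X) Y z \<le> prod_reps C Y z + prod_reps X Y z" for z
  proof -
    have "prod_reps (C \<union> X) Y z = card ({(a, y) \<in> C \<times> Y. a * y = z} \<union> {(a, y) \<in> X \<times> Y. a * y = z})"
      unfolding prod_reps_def by (rule arg_cong[where f = card]) auto
    also have "\<dots> \<le> prod_reps C Y z + prod_reps X Y z"
      unfolding prod_reps_def by (rule card_Un_le)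
    finally show ?thesis .
  qed
  have "L2_set (\<lambda>z. real (prod_reps (C \<union> X) Y z)) T
      \<le> L2_set (\<lambda>z. real (prod_reps C Y z) + real (prod_reps X Y z)) T"
    using Un by (intro L2_set_mono) (auto simp flip: of_nat_add)
  also have "\<dots> \<le> L2_set (\<lambda>z. real (prod_reps C Y z)) T + L2_set (\<lambda>z. real (prod_reps X Y z)) T"
    by (rule L2_set_triangle_ineq)
  finally show ?thesis by (simp add: energy)
qed

lemma add_energy_pair_le_sqrt:
  assumes "finite X" "finite Y"
  shows "add_energy_pair X Y \<le> sqrt (add_energy X) * sqrt (add_energy Y)"
proof -
  define T where "T = (\<lambda>(a, b). a - b) ` (X \<times> X) \<union> (\<lambda>(a, b). a - b) ` (Y \<times> Y)"
  have [simp]: "finite T" using assms by (simp add: T_def)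
  have "real (add_energy_pair X Y) = (\<Sum>d\<in>T. \<bar>real (diff_reps X d)\<bar> * \<bar>real (diff_reps Y d)\<bar>)"
    using add_energy_pair_eq_sum[of X Y T] assms by (simp add: T_def)
  also have "\<dots> \<le> L2_set (\<lambda>d. real (diff_reps X d)) T * L2_set (\<lambda>d. real (diff_reps Y d)) T"
    by (rule L2_set_mult_ineq)
  also have "L2_set (\<lambda>d. real (diff_reps X d)) T = sqrt (add_energy X)"
    using add_energy_pair_eq_sum[of X X T] assms
    by (simp add: T_def L2_set_def add_energy_eq_pair power2_eq_square)
  also have "L2_set (\<lambda>d. real (diff_reps Y d)) T = sqrt (add_energy Y)"
    using add_energy_pair_eq_sum[of Y Y T] assms
    by (simp add: T_def L2_set_def add_energy_eq_pair power2_eq_square)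
  finally show ?thesis .
qed

lemma add_energy_le_cube:
  assumes "finite X"
  shows "add_energy X \<le> card X ^ 3"
proof -
  have "add_energy X \<le> card (X \<times> X \<times> X)"
    unfolding add_energy_def
    by (rule card_inj_on_le[of "\<lambda>(a1, a2, a3, a4). (a1, a2, a3)"])
       (use assms in \<open>auto simp: inj_on_def\<close>)
  then show ?thesis by (simp add: card_cartesian_product power3_eq_cube mult.assoc)
qed

text \<open>
  The set \<open>C\<close> is a maximal subset of \<open>A\<close> whose norms \<open>\<surd>E\<^sub>\<times>(C, Y)\<close> are at most \<open>w\<close> per element of
  \<open>C\<close>. The rate \<open>w\<close> is chosen such that the structured piece found in a set of large additive
  energy, having at least \<open>n/(4K)\<close> elements, respects it; subadditivity then lets that piece be
  added to \<open>C\<close>. By maximality the complement of \<open>C\<close> has small additive energy. The bound is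
  carried along for all \<open>Y \<subseteq> A\<close> because \<open>C\<close> itself and its complement, to which it is finally applied, are
  not known while \<open>C\<close> grows.
\<close>

lemma low_energy_decomposition:
  fixes A :: "real set" and K :: real
  assumes fin: "finite A" and K: "1 \<le> K" "K ^ 14 \<le> real (card A)"
  obtains C where "C \<subseteq> A" "add_energy (A - C) \<le> real (card A) ^ 3 / K"
    "\<And>Y. Y \<subseteq> A \<Longrightarrow> mult_energy_pair C Y \<le> 8256 * real (card A) ^ 3 / K"
proof -
  define n where "n = real (card A)"
  have n: "0 < n" using one_le_power[OF K(1), of 14] K(2) unfolding n_def by linarith
  define w where "w = 4 * K / n * sqrt (516 * n ^ 3 / K ^ 3)"
  have w0: "0 \<le> w" using K n by (simp add: w_def)
  define good where "good = (\<lambda>C. C \<subseteq> A \<and> (\<forall>Y\<subseteq>A. sqrt (mult_energy_pair C Y) \<le> card C * w))"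
  have "good {}" by (simp add: good_def mult_energy_pair_def)
  moreover have "finite {C. good C}"
    by (rule finite_subset[of _ "Pow A"]) (use fin in \<open>auto simp: good_def\<close>)
  ultimately obtain C where C: "good C" and max: "\<And>C'. good C' \<Longrightarrow> C \<subseteq> C' \<Longrightarrow> C = C'"
    using finite_has_maximal[of "{C. good C}"] by blast
  have CA: "C \<subseteq> A" and finC: "finite C" using C fin finite_subset by (auto simp: good_def)

  have add: "\<not> n ^ 3 / K < add_energy (A - C)"
  proof
    assume large: "n ^ 3 / K < add_energy (A - C)"
    have "card (A - C) \<le> n" using fin by (simp add: n_def card_mono)
    then obtain X P where X: "X \<subseteq> A - C" "finite P" "card P \<le> 2 * K * n" "n / (4 * K) \<le> card X"
      "\<And>a. a \<in> X \<Longrightarrow> n / (4 * K) \<le> card {b \<in> A - C. a - b \<in> P}"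
      using large_add_energy_obtains_structured[of "A - C" K n] fin K n large by auto
    have finX: "finite X" using X(1) fin finite_subset by blast
    have "good (C \<union> X)"
      unfolding good_def
    proof (intro conjI allI impI)
      show "C \<union> X \<subseteq> A" using CA X(1) by auto
      fix Y assume Y: "Y \<subseteq> A"
      have finY: "finite Y" using Y fin finite_subset by blast
      have "mult_energy_pair X Y \<le> 516 * n ^ 3 / K ^ 3"
      proof (rule mult_energy_pair_structured_le[where B = "A - C" and P = P])
        show "card X \<le> n" "card Y \<le> n" "card (A - C) \<le> n"
          using X(1) Y fin by (auto simp: n_def intro!: card_mono)
      qed (use K X fin finX finY in \<open>auto simp: n_def\<close>)
      then have "sqrt (mult_energy_pair X Y) \<le> sqrt (516 * n ^ 3 / K ^ 3)" by simp
      also have "\<dots> = n / (4 * K) * w" using K n by (simp add: w_def)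
      also have "\<dots> \<le> card X * w" using X(4) w0 by (intro mult_right_mono) auto
      finally have "sqrt (mult_energy_pair X Y) \<le> card X * w" .
      moreover have "sqrt (mult_energy_pair C Y) \<le> card C * w" using C Y by (auto simp: good_def)
      moreover have "sqrt (mult_energy_pair (C \<union> X) Y) \<le> sqrt (mult_energy_pair C Y) + sqrt (mult_energy_pair X Y)"
        using finC finX finY by (rule sqrt_mult_energy_pair_Un_le)
      moreover have "card (C \<union> X) = card C + card X"
        using X(1) finC finX by (intro card_Un_disjoint) auto
      ultimately show "sqrt (mult_energy_pair (C \<union> X) Y) \<le> card (C \<union> X) * w"
        by (simp add: algebra_simps)
    qed
    then have "C = C \<union> X" by (intro max) auto
    then have "X = {}" using X(1) by auto
    moreover have "0 < n / (4 * K)" using K n by simp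
    ultimately show False using X(4) by simp
  qed
  have mult: "mult_energy_pair C Y \<le> 8256 * n ^ 3 / K" if Y: "Y \<subseteq> A" for Y
  proof -
    have "sqrt (mult_energy_pair C Y) \<le> card C * w" using C Y by (auto simp: good_def)
    also have "\<dots> \<le> n * w" using CA fin w0 by (intro mult_right_mono) (auto simp: n_def card_mono)
    also have "\<dots> = 4 * K * sqrt (516 * n ^ 3 / K ^ 3)" using n by (simp add: w_def)
    finally have "(sqrt (mult_energy_pair C Y))\<^sup>2 \<le> (4 * K * sqrt (516 * n ^ 3 / K ^ 3))\<^sup>2"
      by (intro power_mono) auto
    also have "\<dots> = 16 * K ^ 2 * (516 * n ^ 3 / K ^ 3)" using K n by (simp add: power_mult_distrib)
    also have "\<dots> = 8256 * n ^ 3 / K" using K by (simp add: field_simps power_eq_if)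
    finally show ?thesis by simp
  qed
  show ?thesis
    using that[OF CA] add mult unfolding n_def not_less by blast
qed

lemma powr_ge_half:
  fixes x e :: real
  assumes "1 / 2 \<le> x" "0 \<le> e" "e \<le> 1"
  shows "1 / 2 \<le> x powr e"
proof -
  have "(1 / 2) powr 1 \<le> (1 / 2 :: real) powr e" using assms by (intro powr_mono') auto
  also have "\<dots> \<le> x powr e" using assms by (intro powr_mono2) auto
  finally show ?thesis by simp
qed

theorem theorem1p1:
  fixes \<delta> :: real
  assumes "\<delta> = 2 / 33"
  shows "\<exists>K::real. K > 0 \<and>
    (\<forall>A::real set. finite A \<and> card A \<ge> 2 \<longrightarrow>
      (\<exists>B C. B \<inter> C = {} \<and> A = B \<union> C \<and>
        real (max (add_energy B) (mult_energy C))
          \<le> K * real (card A) powr (3 - \<delta>) * ln (real (card A)) powr (1 - \<delta>) \<and>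
        real (max (add_energy_pair B C) (mult_energy_pair B C))
          \<le> K * real (card A) powr (3 - \<delta> / 2) * ln (real (card A)) powr ((1 - \<delta>) / 2)))"
proof (intro exI[of _ 16512] conjI allI impI)
  fix A :: "real set"
  assume A: "finite A \<and> card A \<ge> 2"
  define n where "n = real (card A)"
  define K where "K = n powr \<delta>"
  have n: "2 \<le> n" using A by (simp add: n_def)
  have K1: "1 \<le> K" using n assms by (simp add: K_def ge_one_powr_ge_zero)
  have "K ^ 14 = n powr (\<delta> * 14)" using n by (simp add: K_def powr_power mult.commute)
  also have "\<dots> \<le> n powr 1" using n assms by (intro powr_mono) auto
  finally have "K ^ 14 \<le> n" using n by simp
  then obtain C where C: "C \<subseteq> A" and add: "add_energy (A - C) \<le> n ^ 3 / K"
    and mult: "\<And>Y. Y \<subseteq> A \<Longrightarrow> mult_energy_pair C Y \<le> 8256 * n ^ 3 / K"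
    using low_energy_decomposition[of A K] A K1 unfolding n_def by blast
  define B where "B = A - C"
  have fin: "finite B" "finite C" using A C by (simp_all add: B_def finite_subset)
  have n3: "n ^ 3 = n powr 3" using n by simp
  have energy: "n ^ 3 / K = n powr (3 - \<delta>)" unfolding n3 K_def by (rule powr_diff[symmetric])
  have pair: "n ^ 3 / sqrt K = n powr (3 - \<delta> / 2)"
  proof -
    have "sqrt K = n powr (\<delta> / 2)" using n by (simp add: K_def powr_half_sqrt_powr)
    then show ?thesis unfolding n3 by (simp add: powr_diff)
  qed
  have ln: "1 / 2 \<le> ln n"
  proof -
    have "ln (1 / n) \<le> 1 / n - 1" using n by (intro ln_le_minus_one) simp
    moreover have "1 / n \<le> 1 / 2" using n by simp
    moreover have "ln (1 / n) = - ln n" using n by (simp add: ln_div)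
    ultimately show ?thesis by linarith
  qed

  \<comment> \<open>This is where the logarithmic factors are absorbed.\<close>
  have bound: "real M \<le> 16512 * x * ln n powr e"
    if "real M \<le> 8256 * x" "0 \<le> x" "0 \<le> e" "e \<le> 1" for M x e
  proof -
    have "8256 * x = 16512 * x * (1 / 2)" by simp
    also have "\<dots> \<le> 16512 * x * ln n powr e"
      using that powr_ge_half[OF ln] by (intro mult_left_mono) auto
    finally show ?thesis using that by linarith
  qed

  have "real (max (add_energy B) (mult_energy C)) \<le> 8256 * (n ^ 3 / K)"
  proof -
    have "0 \<le> n ^ 3 / K" using n K1 by simp
    then show ?thesis
      using add mult[OF C] unfolding B_def mult_energy_eq_pair of_nat_max
        times_divide_eq_right[symmetric] by linarith
  qed
  then have 1: "real (max (add_energy B) (mult_energy C)) \<le> 16512 * n powr (3 - \<delta>) * ln n powr (1 - \<delta>)"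
    unfolding energy by (rule bound) (use assms in simp_all)

  have "real (max (add_energy_pair B C) (mult_energy_pair B C)) \<le> 8256 * (n ^ 3 / sqrt K)"
  proof -
    have "real (add_energy C) \<le> n ^ 3"
    proof -
      have "real (add_energy C) \<le> real (card C) ^ 3"
        using add_energy_le_cube[OF fin(2)] by (simp flip: of_nat_power)
      also have "\<dots> \<le> n ^ 3" using A C by (intro power_mono) (auto simp: n_def card_mono)
      finally show ?thesis .
    qed
    have "add_energy_pair B C \<le> sqrt (add_energy B) * sqrt (add_energy C)"
      using fin by (rule add_energy_pair_le_sqrt)
    also have "\<dots> \<le> sqrt (n ^ 3 / K) * sqrt (n ^ 3)"
      using add \<open>real (add_energy C) \<le> n ^ 3\<close> n K1 by (intro mult_mono) (auto simp: B_def)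
    also have "\<dots> = n ^ 3 / sqrt K"
      using n by (simp add: real_sqrt_divide)
    finally have "add_energy_pair B C \<le> n ^ 3 / sqrt K" .
    moreover have "n ^ 3 / K \<le> n ^ 3 / sqrt K"
    proof -
      have "sqrt K \<le> sqrt (K * K)" using K1 by (intro real_sqrt_le_mono) simp
      then have "sqrt K \<le> K" using K1 by simp
      then show ?thesis using n K1 by (intro divide_left_mono) auto
    qed
    moreover have "mult_energy_pair B C \<le> 8256 * n ^ 3 / K"
      using mult[of B] by (simp add: B_def mult_energy_pair_commute)
    moreover have "0 \<le> n ^ 3 / sqrt K" using n K1 by simp
    ultimately show ?thesis
      unfolding of_nat_max times_divide_eq_right[symmetric] by linarith
  qed
  then have 2: "real (max (add_energy_pair B C) (mult_energy_pair B C))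
      \<le> 16512 * n powr (3 - \<delta> / 2) * ln n powr ((1 - \<delta>) / 2)"
    unfolding pair by (rule bound) (use assms in simp_all)
  show "\<exists>B C. B \<inter> C = {} \<and> A = B \<union> C \<and>
        real (max (add_energy B) (mult_energy C))
          \<le> 16512 * real (card A) powr (3 - \<delta>) * ln (real (card A)) powr (1 - \<delta>) \<and>
        real (max (add_energy_pair B C) (mult_energy_pair B C))
          \<le> 16512 * real (card A) powr (3 - \<delta> / 2) * ln (real (card A)) powr ((1 - \<delta>) / 2)"
    using 1 2 C unfolding n_def by (intro exI[of _ B] exI[of _ C]) (auto simp: B_def)
qed simp

end
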